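(* Let $\mathcal{G}$ be a strongly connected, weight-balanced weighted digraph with $n\geq 2$ vertices and Laplacian $\mathsf{L}\in\mathbb{R}^{n\times n}$, and let $\mathbf{L}=\mathsf{L}\otimes\mathsf{I}_d\in\mathbb{R}^{nd\times nd}$. For each $i\in\{1,\dots,n\}$ let $f^i:\mathbb{R}^d\to\mathbb{R}$ be convex and differentiable with globally Lipschitz continuous gradient; let $f(x)=\sum_{i=1}^n f^i(x)$ for $x\in\mathbb{R}^d$, and assume that $f$ has a minimizer. Let $\tilde f(\boldsymbol{x})=\sum_{i=1}^n f^i(x^i)$ for $\boldsymbol{x}=(x^1,\dots,x^n)\in(\mathbb{R}^d)^n$. Let $K\in\mathbb{R}_{>0}$ be the Lipschitz constant of $\nabla\tilde f$ and define $h:\mathbb{R}_{>0}\to\mathbb{R}$ by $$h(r)=\frac12\Lambda_*(\mathsf{L}+\mathsf{L}^T)\left(-\frac{r^4+3r^2+2}{r}+\sqrt{\left(\frac{r^4+3r^2+2}{r}\right)^2-4}\right)+\frac{Kr^2}{1+r^2},$$ where $\Lambda_*(\cdot)$ denotes the non-zero eigenvalue with smallest absolute value. Then there exists $\beta^*\in\mathbb{R}_{>0}$ with $h(\beta^* )=0$ such that, for all $0<\beta<\beta^*$, setting $\alpha=\frac{\beta^2+2}{\beta}$, the projection $\boldsymbol{x}(t)$ onto the first component of any trajectory $(\boldsymbol{x}(t),\boldsymbol{z}(t))$, $t\ge0$, of the dynamics on $\mathbb{R}^{nd}\times\mathbb{R}^{nd}$ $$\dot{\boldsymbol{x}}+\alpha\mathbf{L}\boldsymbol{x}+\mathbf{L}\boldsymbol{z}=-\nabla\tilde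 f(\boldsymbol{x}),\qquad\dot{\boldsymbol{z}}=\mathbf{L}\boldsymbol{x}$$ asymptotically converges, as $t\to\infty$, to the set of solutions of the problem $$\text{minimize } \tilde f(\boldsymbol{x})\quad\text{subject to}\quad\mathbf{L}\boldsymbol{x}=\mathbf{0}_{nd}.$$ Moreover, if $f$ has a finite number of critical points, then the limit of the projection onto the first component of each trajectory is a solution of this constrained problem.
   Context: A weighted digraph is $\mathcal{G}=(\mathcal{V},\mathcal{E},\mathsf{A})$ with finite vertex set $\mathcal{V}=\{v_1,\dots,v_n\}$, edge set $\mathcal{E}\subseteq\mathcal{V}\times\mathcal{V}$, and adjacency matrix $\mathsf{A}=(a_{ij})\in\mathbb{R}_{\ge0}^{n\times n}$ with $a_{ij}>0$ if $(v_i,v_j)\in\mathcal{E}$ and $a_{ij}=0$ otherwise. Its Laplacian is $\mathsf{L}=\mathsf{D}_{\mathrm{out}}-\mathsf{A}$, where $\mathsf{D}_{\mathrm{out}}$ is the diagonal matrix with entries $\sum_{j}a_{ij}$. It is strongly connected if there is a directed path between any ordered pair of distinct vertices, and weight-balanced if $\sum_j a_{ij}=\sum_j a_{ji}$ for every $i$. $\mathsf{I}_d$ is the $d\times d$ identity matrix, $\otimes$ the Kronecker product. A Lipschitz constant of a globally Lipschitz map $g$ is a $K$ such that $\|g(y)-g(y')\|\le K\|y-y'\|$ for all $y,y'$ (Euclidean norms). A critical point of $f$ is a point $x$ with $\nabla f(x)=0$. *)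

theory Defs
  imports "HOL-Analysis.Analysis"
begin

section \<open>Weighted digraphs and their Laplacians\<close>

text \<open>The vertices are the elements of the finite index type \<open>'n\<close>; loops are allowed.\<close>

definition weighted_digraph :: "('n \<times> 'n) set \<Rightarrow> real^'n^'n \<Rightarrow> bool" where
  "weighted_digraph E A \<longleftrightarrow>
     (\<forall>i j. ((i, j) \<in> E \<longrightarrow> A $ i $ j > 0) \<and> ((i, j) \<notin> E \<longrightarrow> A $ i $ j = 0))"

definition strongly_connected :: "('n \<times> 'n) set \<Rightarrow> bool" where
  "strongly_connected E \<longleftrightarrow> (\<forall>i j. i \<noteq> j \<longrightarrow> (i, j) \<in> E\<^sup>+)"

definition weight_balanced :: "real^'n^'n \<Rightarrow> bool" where
  "weight_balanced A \<longleftrightarrow> (\<forall>i. (\<Sum>j\<in>UNIV. A $ i $ j) = (\<Sum>j\<in>UNIV. A $ j $ i))"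

definition out_degree_matrix :: "real^'n^'n \<Rightarrow> real^'n^'n" where
  "out_degree_matrix A = (\<chi> i j. if i = j then (\<Sum>k\<in>UNIV. A $ i $ k) else 0)"

definition laplacian :: "real^'n^'n \<Rightarrow> real^'n^'n" where
  "laplacian A = out_degree_matrix A - A"


section \<open>Kronecker product and stacked vectors\<close>

text \<open>The space of dimension \<open>n * d\<close> is \<open>real^('n \<times> 'd)\<close>: the index \<open>(i, k)\<close> is the
  \<open>k\<close>-th coordinate of the \<open>i\<close>-th block. Its norm is the Euclidean norm.\<close>

definition kronecker ::
    "real^'b^'a \<Rightarrow> real^'d^'c \<Rightarrow> real^('b::finite \<times> 'd::finite)^('a::finite \<times> 'c::finite)"
    (infixl \<open>\<otimes>\<^sub>K\<close> 70) where
  "M \<otimes>\<^sub>K N = (\<chi> p q. M $ fst p $ fst q * N $ snd p $ snd q)"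

definition block :: "real^('n::finite \<times> 'd::finite) \<Rightarrow> 'n \<Rightarrow> real^'d" where
  "block x i = (\<chi> k. x $ (i, k))"

lemma block_laplacian_kronecker:
  fixes M :: "real^'n^'n" and x :: "real^('n::finite \<times> 'd::finite)"
  shows "block ((M \<otimes>\<^sub>K (mat 1 :: real^'d^'d)) *v x) i = (\<Sum>j\<in>UNIV. M $ i $ j *\<^sub>R block x j)"
proof -
  have "(\<Sum>q\<in>UNIV. M $ i $ fst q * (mat 1 :: real^'d^'d) $ k $ snd q * x $ q)
      = (\<Sum>j\<in>UNIV. M $ i $ j * x $ (j, k))" for k
  proof -
    have "(\<Sum>q\<in>UNIV. M $ i $ fst q * (mat 1 :: real^'d^'d) $ k $ snd q * x $ q)
      = (\<Sum>j\<in>UNIV. \<Sum>l\<in>UNIV. M $ i $ j * (mat 1 :: real^'d^'d) $ k $ l * x $ (j, l))"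
      unfolding UNIV_Times_UNIV[symmetric] sum.cartesian_product by (simp add: case_prod_beta)
    also have "\<dots> = (\<Sum>j\<in>UNIV. \<Sum>l\<in>UNIV. if k = l then M $ i $ j * x $ (j, l) else 0)"
      by (intro sum.cong) (auto simp: mat_def)
    finally show ?thesis by simp
  qed
  then show ?thesis
    by (simp add: vec_eq_iff block_def kronecker_def matrix_vector_mult_def)
qed


section \<open>Gradients\<close>

definition grad :: "('a::real_inner \<Rightarrow> real) \<Rightarrow> 'a \<Rightarrow> 'a" where
  "grad g x = (THE D. GDERIV g x :> D)"

lemma grad_eqI:
  assumes "GDERIV g x :> D"
  shows "grad g x = D"
  unfolding grad_def
proof (rule the_equality)
  fix D' assume "GDERIV g x :> D'"
  with assms have "(\<lambda>h. h \<bullet> D) = (\<lambda>h. h \<bullet> D')"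
    unfolding gderiv_def by (rule has_derivative_unique)
  then have "(D' - D) \<bullet> D = (D' - D) \<bullet> D'"
    by (rule fun_cong)
  then have "(D' - D) \<bullet> (D' - D) = 0"
    by (simp add: inner_diff_right)
  then show "D' = D" by simp
qed (rule assms)

lemma GDERIV_grad:
  fixes g :: "'a::euclidean_space \<Rightarrow> real"
  assumes "g differentiable at x"
  shows "GDERIV g x :> grad g x"
proof -
  obtain g' where g': "(g has_derivative g') (at x)"
    using assms by (auto simp: differentiable_def)
  then interpret linear g' by (rule has_derivative_linear)
  have "g' h = h \<bullet> (\<Sum>b\<in>Basis. g' b *\<^sub>R b)" for h
  proof -
    have "g' h = g' (\<Sum>b\<in>Basis. (h \<bullet> b) *\<^sub>R b)" by (simp add: euclidean_representation)
    also have "\<dots> = (\<Sum>b\<in>Basis. (h \<bullet> b) * g' b)" by (simp add: sum scale)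
    finally show ?thesis by (simp add: inner_sum_right mult.commute)
  qed
  then have "g' = (\<lambda>h. h \<bullet> (\<Sum>b\<in>Basis. g' b *\<^sub>R b))" by (rule ext)
  with g' have "GDERIV g x :> (\<Sum>b\<in>Basis. g' b *\<^sub>R b)" by (simp add: gderiv_def)
  then show ?thesis using grad_eqI by metis
qed


section \<open>Eigenvalues and the threshold function\<close>

text \<open>Only real eigenvalues are considered; below, the matrix is symmetric.\<close>

definition real_eigenvalue :: "real^'n^'n \<Rightarrow> real \<Rightarrow> bool" where
  "real_eigenvalue M c \<longleftrightarrow> (\<exists>v. v \<noteq> 0 \<and> M *v v = c *\<^sub>R v)"

definition Lambda_star :: "real^'n^'n \<Rightarrow> real" where
  "Lambda_star M = (ARG_MIN abs c. real_eigenvalue M c \<and> c \<noteq> 0)"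

definition h_fun :: "real^'n^'n \<Rightarrow> real \<Rightarrow> real \<Rightarrow> real" where
  "h_fun L K r =
     1/2 * Lambda_star (L + transpose L) *
       (- ((r^4 + 3 * r^2 + 2) / r) + sqrt (((r^4 + 3 * r^2 + 2) / r)^2 - 4))
     + K * r^2 / (1 + r^2)"


section \<open>The optimization problem and the dynamics\<close>

definition f_sum :: "('n::finite \<Rightarrow> real^'d \<Rightarrow> real) \<Rightarrow> real^'d \<Rightarrow> real" where
  "f_sum f x = (\<Sum>i\<in>UNIV. f i x)"

definition f_tilde :: "('n \<Rightarrow> real^'d \<Rightarrow> real) \<Rightarrow> real^('n::finite \<times> 'd::finite) \<Rightarrow> real" where
  "f_tilde f x = (\<Sum>i\<in>UNIV. f i (block x i))"

definition solution_set ::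
    "real^'m^'m \<Rightarrow> (real^'m \<Rightarrow> real) \<Rightarrow> (real^'m) set" where
  "solution_set LL g = {x. is_arg_min g (\<lambda>y. LL *v y = 0) x}"

text \<open>Trajectories are defined on the closed half-line; the derivatives at time 0 are
  one-sided. Values at negative times are irrelevant.\<close>

definition is_trajectory ::
    "real^'m^'m \<Rightarrow> (real^'m \<Rightarrow> real) \<Rightarrow> real
      \<Rightarrow> (real \<Rightarrow> real^'m) \<Rightarrow> (real \<Rightarrow> real^'m) \<Rightarrow> bool" where
  "is_trajectory LL g \<alpha> x z \<longleftrightarrow> (\<forall>t\<ge>0. \<exists>x' z'.
     (x has_vector_derivative x') (at t within {0..}) \<and>
     (z has_vector_derivative z') (at t within {0..}) \<and>
     x' + \<alpha> *\<^sub>R (LL *v x t) + LL *v z t = - grad g (x t) \<and>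
     z' = LL *v x t)"

text \<open>Convergence to a set is not expressed by \<^const>\<open>infdist\<close>, because the infimum distance
  to the empty set is 0 by convention.\<close>

definition converges_to_set :: "(real \<Rightarrow> 'a::metric_space) \<Rightarrow> 'a set \<Rightarrow> bool" where
  "converges_to_set x S \<longleftrightarrow> (\<forall>\<epsilon>>0. \<forall>\<^sub>F t in at_top. \<exists>y\<in>S. dist (x t) y < \<epsilon>)"

end

theory Submission
  imports Defs
begin

text \<open>The dynamics is a gradient flow of the objective \<open>F\<close> coupled to a multiplier \<open>z\<close> through the
  Laplacian \<open>B\<close>. Since the digraph is weight-balanced,
  \<open>v \<bullet> B v = 1/2 * (\<Sum>i j. a\<^sub>i\<^sub>j (v\<^sub>i - v\<^sub>j)\<^sup>2)\<close>: the operator \<open>B\<close> need not be symmetric, but it is positive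
  semidefinite, and strong connectivity makes the consensus vectors the null vectors of this form.
  These facts and the spectral gap on the orthogonal complement of the kernel
  (\<open>Lambda_star_spectral_gap\<close>) are all that is used about the graph.

  Let \<open>(x\<^sub>s, z\<^sub>s)\<close> be an equilibrium and put \<open>y = x - x\<^sub>s\<close>, \<open>w = z - z\<^sub>s\<close>,
  \<open>g = \<nabla>F(x) - \<nabla>F(x\<^sub>s)\<close>. The component of \<open>z\<close> along the kernel of \<open>B\<close> is conserved, and \<open>z\<^sub>s\<close> can be
  chosen so that \<open>w\<close> is orthogonal to this kernel (\<open>ex_equilibrium_component\<close>); there the spectral gap
  \<open>\<Lambda>\<close> applies. The Lyapunov function is \<open>V = (\<parallel>y\<parallel>\<^sup>2 + \<parallel>\<beta> y + w\<parallel>\<^sup>2) / 2\<close>. Along the flow with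
  \<open>\<alpha> = (\<beta>\<^sup>2 + 2) / \<beta>\<close> its derivative is the negative of a quadratic form in \<open>(y, w)\<close>, minus
  \<open>(1 + \<beta>\<^sup>2) (y \<bullet> g) + \<beta> (w \<bullet> g)\<close>. The form is governed by a definite \<open>2 \<times> 2\<close> matrix of determinant
  \<open>1/4\<close>, whose smallest eigenvalue \<open>m\<close> satisfies \<open>-2 \<Lambda> m = 1/2 * \<Lambda> (-p + sqrt (p\<^sup>2 - 4))\<close> with
  \<open>p = (\<beta>\<^sup>4 + 3 \<beta>\<^sup>2 + 2) / \<beta>\<close>. Cocoercivity of the gradient, \<open>y \<bullet> g \<ge> \<parallel>g\<parallel>\<^sup>2 / K\<close>, absorbs the indefinite
  term \<open>\<beta> (w \<bullet> g)\<close> at the price of \<open>K \<beta>\<^sup>2 / (2 (1 + \<beta>\<^sup>2)) \<parallel>w\<parallel>\<^sup>2\<close>. The remaining coefficient of \<open>\<parallel>w\<parallel>\<^sup>2\<close> is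
  exactly \<open>h(\<beta>) / 2\<close>, and \<open>h < 0\<close> to the left of its first zero (\<open>h_fun_first_zero\<close>), which is the
  \<open>\<beta>\<^sup>*\<close> of the theorem.

  Every trajectory even converges to a single point, so both claims follow at once. As \<open>V \<ge> 0\<close>, the
  dissipation comes arbitrarily close to \<open>0\<close> at arbitrarily late times. Along such times \<open>x\<close> has a
  limit point \<open>l\<close>, and vanishing dissipation forces \<open>B l = 0\<close>, \<open>\<nabla>F(l) = \<nabla>F(x\<^sub>s)\<close> and \<open>w \<rightarrow> 0\<close>. Hence
  \<open>(l, z\<^sub>s)\<close> is another equilibrium to which the same argument applies: the function \<open>V\<close> built on it
  is nonincreasing and tends to \<open>0\<close> along a subsequence, hence tends to \<open>0\<close>
  (\<open>saddle_flow_converges\<close>). Finally \<open>\<nabla>F(l)\<close> is orthogonal to the feasible subspace, so the convex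
  function \<open>F\<close> is minimal at \<open>l\<close> among the feasible points.\<close>


section \<open>Positive semidefinite, possibly non-symmetric operators\<close>

text \<open>For a positive semidefinite operator the kernel of the adjoint contains the kernel, even without
  symmetry: along the line \<open>v + t c\<close> the form is affine in \<open>t\<close> with slope \<open>c \<bullet> L v\<close>, and an affine
  function that is bounded below is constant. This is why sums over the vertices are conserved by
  the multiplier dynamics.\<close>
lemma psd_kernel_orthogonal_range:
  fixes L :: "'a::real_inner \<Rightarrow> 'a"
  assumes "linear L" and psd: "\<And>v. 0 \<le> v \<bullet> L v" and "L c = 0"
  shows "c \<bullet> L v = 0"
proof (rule ccontr)
  assume ne: "c \<bullet> L v \<noteq> 0"
  define t where "t = - (v \<bullet> L v + 1) / (c \<bullet> L v)"
  have "(v + t *\<^sub>R c) \<bullet> L (v + t *\<^sub>R c) = v \<bullet> L v + t * (c \<bullet> L v)"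
    using \<open>linear L\<close> \<open>L c = 0\<close> by (simp add: linear_add linear_scale inner_add_left)
  also have "\<dots> = - 1" using ne by (simp add: t_def)
  finally show False using psd[of "v + t *\<^sub>R c"] by simp
qed

text \<open>The residual \<open>e\<close> of the orthogonal projection of \<open>b\<close> onto the range is orthogonal to \<open>L e\<close>, so it is
  a kernel vector; as such it is orthogonal to \<open>b\<close>, which leaves only \<open>e = 0\<close>.\<close>
lemma psd_range:
  fixes L :: "'a::euclidean_space \<Rightarrow> 'a"
  assumes lin: "linear L" and null: "\<And>v. v \<bullet> L v = 0 \<Longrightarrow> L v = 0"
    and orth: "\<And>c. L c = 0 \<Longrightarrow> c \<bullet> b = 0"
  shows "\<exists>z. L z = b"
proof -
  obtain r e where r: "r \<in> span (range L)" and e: "\<And>v. v \<in> span (range L) \<Longrightarrow> orthogonal e v"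
    and b: "b = r + e"
    using orthogonal_subspace_decomp_exists[of "range L" b] by metis
  have "subspace (range L)" using lin by (rule linear_subspace_image) simp
  then have sp: "span (range L) = range L" by (simp add: span_eq_iff)
  have "e \<bullet> L e = 0" using e sp by (simp add: orthogonal_def)
  then have "e \<bullet> b = 0" by (intro orth null)
  moreover have "e \<bullet> r = 0" using e r by (simp add: orthogonal_def)
  ultimately have "e = 0" by (simp add: b inner_add_right)
  then show ?thesis using r sp b by auto
qed

text \<open>Preimages of \<open>b\<close> are determined up to the kernel; this freedom is used to match the conserved
  kernel component of the initial multiplier \<open>z0\<close>.\<close>
lemma ex_equilibrium_component:
  fixes L :: "'a::euclidean_space \<Rightarrow> 'a"
  assumes lin: "linear L" and null: "\<And>v. v \<bullet> L v = 0 \<Longrightarrow> L v = 0"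
    and orth: "\<And>c. L c = 0 \<Longrightarrow> c \<bullet> b = 0"
  shows "\<exists>z. L z = b \<and> (\<forall>c. L c = 0 \<longrightarrow> c \<bullet> (z0 - z) = 0)"
proof -
  obtain z1 where z1: "L z1 = b" using psd_range[OF lin null orth] by blast
  let ?C = "{c. L c = 0}"
  obtain c d where c: "c \<in> span ?C" and d: "\<And>v. v \<in> span ?C \<Longrightarrow> orthogonal d v"
    and eq: "z1 - z0 = c + d"
    using orthogonal_subspace_decomp_exists[of ?C "z1 - z0"] by metis
  have "subspace ?C" using lin by (rule linear_subspace_kernel)
  then have sp: "span ?C = ?C" by (simp add: span_eq_iff)
  have "L (z1 - c) = b" using c sp z1 lin by (simp add: linear_diff)
  moreover have "c' \<bullet> (z0 - (z1 - c)) = 0" if "L c' = 0" for c'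
  proof -
    have "z0 - (z1 - c) = - d" using eq by (simp add: algebra_simps)
    then show ?thesis using d[of c'] that sp by (simp add: orthogonal_def inner_commute)
  qed
  ultimately show ?thesis by blast
qed

section \<open>The spectral gap\<close>

lemma quadratic_nonneg_linear_coeff_zero:
  fixes p q :: real
  assumes "\<And>t. 0 \<le> 2 * t * p + t\<^sup>2 * q"
  shows "p = 0"
proof (rule ccontr)
  assume "p \<noteq> 0"
  define r where "r = \<bar>q\<bar> + 1"
  have r: "0 < r" "q < r" by (auto simp: r_def)
  have "0 \<le> 2 * (- p / r) * p + (- p / r)\<^sup>2 * q" by (rule assms)
  also have "\<dots> = (p / r)\<^sup>2 * (q - 2 * r)" using r by (simp add: power2_eq_square field_simps)
  also have "\<dots> < 0" using r \<open>p \<noteq> 0\<close> by (intro mult_pos_neg) auto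
  finally show False by simp
qed

text \<open>The value \<open>Lambda_star\<close> is identified with the minimum \<open>\<mu>\<close> of the Rayleigh quotient of the symmetric
  part on the orthogonal complement \<open>N\<close> of the kernel. Stationarity at a minimizer \<open>v0\<close> makes \<open>\<mu>\<close> an
  eigenvalue. Conversely, an eigenvector of any non-zero eigenvalue lies in the range and therefore
  in \<open>N\<close>, so its eigenvalue is at least \<open>\<mu>\<close>. The vector \<open>u\<close> guarantees that \<open>N\<close> is not trivial.\<close>
lemma Lambda_star_spectral_gap:
  fixes M :: "real^'n^'n"
  assumes psd: "\<And>v. 0 \<le> v \<bullet> (M *v v)" and null: "\<And>v. v \<bullet> (M *v v) = 0 \<Longrightarrow> M *v v = 0"
    and ne: "M *v u \<noteq> 0"
  shows "0 < Lambda_star (M + transpose M)"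
    and "(\<And>c. M *v c = 0 \<Longrightarrow> c \<bullet> v = 0) \<Longrightarrow>
      Lambda_star (M + transpose M) * (v \<bullet> v) \<le> 2 * (v \<bullet> (M *v v))"
proof -
  let ?S = "M + transpose M"
  define N where "N = {v. \<forall>c. M *v c = 0 \<longrightarrow> c \<bullet> v = 0}"
  have tr: "a \<bullet> (transpose M *v b) = b \<bullet> (M *v a)" for a b
    by (metis dot_lmul_matrix inner_commute
        transpose_matrix_vector)
  have S: "a \<bullet> (?S *v b) = a \<bullet> (M *v b) + b \<bullet> (M *v a)" for a b
    by (simp only: matrix_vector_mult_add_rdistrib inner_add_right tr)
  have kerorth: "c \<bullet> (M *v v) = 0" if "M *v c = 0" for c v
    using psd_kernel_orthogonal_range[of "(*v) M" c v] psd that by simp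
  have rng: "M *v v \<in> N" for v using kerorth by (auto simp: N_def)
  have SN: "?S *v v \<in> N" for v
    using kerorth by (auto simp: N_def S)
  have Nsub: "subspace N"
    by (auto simp: N_def subspace_def inner_add_right)
  have "closed N" using Nsub by (rule closed_subspace)
  then have cpt: "compact (sphere 0 1 \<inter> N)" by (simp add: compact_Int_closed)
  have "(1 / norm (M *v u)) *\<^sub>R (M *v u) \<in> sphere 0 1 \<inter> N"
    using ne rng Nsub by (auto simp: subspace_scale)
  then have nonempty: "sphere 0 1 \<inter> N \<noteq> {}" by blast
  have cont: "continuous_on (sphere 0 1 \<inter> N) (\<lambda>v. v \<bullet> (?S *v v))"
    by (intro continuous_intros linear_continuous_on matrix_vector_mul_bounded_linear)
  obtain v0 where v0: "v0 \<in> sphere 0 1 \<inter> N"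
    and min: "\<And>v. v \<in> sphere 0 1 \<inter> N \<Longrightarrow> v0 \<bullet> (?S *v v0) \<le> v \<bullet> (?S *v v)"
    using continuous_attains_inf[OF cpt nonempty cont] by auto
  define \<mu> where "\<mu> = v0 \<bullet> (?S *v v0)"
  have v01: "v0 \<bullet> v0 = 1" "v0 \<noteq> 0" using v0 by (auto simp: norm_eq_1)
  have low: "\<mu> * (v \<bullet> v) \<le> v \<bullet> (?S *v v)" if "v \<in> N" for v
  proof (cases "v = 0")
    case False
    let ?u = "(1 / norm v) *\<^sub>R v"
    have "?u \<in> sphere 0 1 \<inter> N" using False that Nsub by (auto simp: subspace_scale)
    then have "\<mu> \<le> ?u \<bullet> (?S *v ?u)" unfolding \<mu>_def by (rule min)
    also have "\<dots> = (v \<bullet> (?S *v v)) / (norm v)\<^sup>2"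
      by (simp add: matrix_vector_mult_scaleR power2_eq_square)
    finally show ?thesis using False by (simp add: power2_norm_eq_inner pos_le_divide_eq)
  qed simp
  have \<mu>pos: "0 < \<mu>"
  proof -
    have "M *v v0 \<noteq> 0"
    proof
      assume "M *v v0 = 0"
      then have "v0 \<bullet> v0 = 0" using v0 by (auto simp: N_def)
      then show False using v01 by simp
    qed
    then have "v0 \<bullet> (M *v v0) \<noteq> 0" using null by blast
    with psd[of v0] show ?thesis by (simp add: \<mu>_def S)
  qed
  have eig: "?S *v v0 = \<mu> *\<^sub>R v0"
  proof -
    \<comment> \<open>the residual lies in \<open>N\<close> itself, so it is an admissible direction of variation\<close>
    define e where "e = ?S *v v0 - \<mu> *\<^sub>R v0"
    have eN: "e \<in> N" using SN v0 Nsub by (auto simp: e_def intro!: subspace_diff subspace_scale)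
    have "0 \<le> 2 * t * (e \<bullet> e) + t\<^sup>2 * (e \<bullet> (?S *v e) - \<mu> * (e \<bullet> e))" for t
    proof -
      have "v0 + t *\<^sub>R e \<in> N" using eN v0 Nsub by (auto intro!: subspace_add subspace_scale)
      from low[OF this]
      have "0 \<le> (v0 + t *\<^sub>R e) \<bullet> (?S *v (v0 + t *\<^sub>R e)) - \<mu> * ((v0 + t *\<^sub>R e) \<bullet> (v0 + t *\<^sub>R e))"
        by simp
      also have "\<dots> = (v0 \<bullet> (?S *v v0) - \<mu> * (v0 \<bullet> v0)) + 2 * t * (e \<bullet> (?S *v v0) - \<mu> * (e \<bullet> v0))
          + t\<^sup>2 * (e \<bullet> (?S *v e) - \<mu> * (e \<bullet> e))"
        unfolding S
        by (simp add: matrix_vector_right_distrib matrix_vector_mult_scaleR inner_add_left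
            inner_add_right inner_commute[of v0 e] power2_eq_square algebra_simps)
      also have "v0 \<bullet> (?S *v v0) - \<mu> * (v0 \<bullet> v0) = 0" by (simp add: v01 \<mu>_def)
      also have "e \<bullet> (?S *v v0) - \<mu> * (e \<bullet> v0) = e \<bullet> e"
        using arg_cong[OF e_def, of "(\<bullet>) e"] by (simp only: inner_diff_right inner_scaleR_right)
      finally show ?thesis by simp
    qed
    then have "e \<bullet> e = 0" by (rule quadratic_nonneg_linear_coeff_zero)
    then show ?thesis by (simp add: e_def)
  qed
  have ev: "real_eigenvalue ?S \<mu>" using eig v01 by (auto simp: real_eigenvalue_def)
  have least: "\<mu> \<le> c" if c: "real_eigenvalue ?S c" "c \<noteq> 0" for c
  proof -
    obtain v where v: "v \<noteq> 0" "?S *v v = c *\<^sub>R v" using c by (auto simp: real_eigenvalue_def)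
    have "c *\<^sub>R v \<in> N" using SN v(2) by metis
    then have "(1 / c) *\<^sub>R (c *\<^sub>R v) \<in> N" by (rule subspace_scale[OF Nsub])
    then have "v \<in> N" using c by simp
    from low[OF this] have "\<mu> * (v \<bullet> v) \<le> c * (v \<bullet> v)" by (simp add: v)
    then show ?thesis using v by simp
  qed
  have "is_arg_min abs (\<lambda>c. real_eigenvalue ?S c \<and> c \<noteq> 0) \<mu>"
    unfolding is_arg_min_linorder using ev \<mu>pos least by fastforce
  then have "is_arg_min abs (\<lambda>c. real_eigenvalue ?S c \<and> c \<noteq> 0) (Lambda_star ?S)"
    unfolding Lambda_star_def arg_min_def by (rule someI)
  then have l: "real_eigenvalue ?S (Lambda_star ?S)" "Lambda_star ?S \<noteq> 0" "\<bar>Lambda_star ?S\<bar> \<le> \<bar>\<mu>\<bar>"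
    unfolding is_arg_min_linorder using ev \<mu>pos by auto
  then have eq: "Lambda_star ?S = \<mu>" using least[of "Lambda_star ?S"] \<mu>pos by linarith
  show "0 < Lambda_star ?S" using eq \<mu>pos by simp
  show "Lambda_star ?S * (v \<bullet> v) \<le> 2 * (v \<bullet> (M *v v))" if "\<And>c. M *v c = 0 \<Longrightarrow> c \<bullet> v = 0"
    using low[of v] that by (simp add: eq N_def S)
qed

section \<open>The threshold function\<close>

text \<open>Rationalizing the square root gives \<open>h r = K r\<^sup>2 / (1 + r\<^sup>2) - 2 \<Lambda> / q r\<close> with
  \<open>q r = p r + sqrt ((p r)\<^sup>2 - 4)\<close> between \<open>p r\<close> and \<open>2 p r\<close>. Near \<open>0\<close> the negative term is of
  order \<open>r\<close> and dominates; for large \<open>r\<close> the positive term approaches \<open>K\<close> while the other one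
  vanishes. The smallest zero exists by compactness.\<close>
lemma h_fun_first_zero:
  assumes \<Lambda>: "0 < Lambda_star (L + transpose L)" and K: "0 < K"
  shows "\<exists>\<beta>>0. h_fun L K \<beta> = 0 \<and> (\<forall>r. 0 < r \<and> r < \<beta> \<longrightarrow> h_fun L K r < 0)"
proof -
  define \<Lambda>' where "\<Lambda>' = Lambda_star (L + transpose L)"
  define p where "p r = (r^4 + 3 * r^2 + 2) / r" for r :: real
  define q where "q r = p r + sqrt ((p r)\<^sup>2 - 4)" for r
  have \<Lambda>pos: "0 < \<Lambda>'" using \<Lambda> by (simp add: \<Lambda>'_def)
  have p2: "2 \<le> p r" if "0 < r" for r
  proof -
    have "r^4 + 3 * r^2 + 2 - 2 * r = r^4 + 2 * r^2 + 1 + (r - 1)\<^sup>2"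
      by (simp add: power2_eq_square algebra_simps)
    also have "\<dots> \<ge> 0" by simp
    finally show ?thesis using that by (simp add: p_def field_simps)
  qed
  have h: "h_fun L K r = 1/2 * \<Lambda>' * (- p r + sqrt ((p r)\<^sup>2 - 4)) + K * r^2 / (1 + r^2)" for r
    by (simp add: h_fun_def \<Lambda>'_def p_def)
  have q: "p r \<le> q r" "q r \<le> 2 * p r" if "0 < r" for r
  proof -
    have "4 \<le> (p r)\<^sup>2" using power_mono[OF p2[OF that], of 2] by simp
    then show "p r \<le> q r" by (simp add: q_def)
    have "sqrt ((p r)\<^sup>2 - 4) \<le> sqrt ((p r)\<^sup>2)" by (rule real_sqrt_le_mono) simp
    then show "q r \<le> 2 * p r" using p2[OF that] by (simp add: q_def)
  qed
  have hq: "h_fun L K r = K * r^2 / (1 + r^2) - 2 * \<Lambda>' / q r" if "0 < r" for r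
  proof -
    have "4 \<le> (p r)\<^sup>2" using power_mono[OF p2[OF that], of 2] by simp
    then have "(- p r + sqrt ((p r)\<^sup>2 - 4)) * q r = - 4"
      by (simp add: q_def algebra_simps power2_eq_square)
    moreover have "q r > 0" using q(1)[OF that] p2[OF that] by linarith
    ultimately have "- p r + sqrt ((p r)\<^sup>2 - 4) = - 4 / q r" by (simp add: field_simps)
    then show ?thesis by (simp add: h)
  qed
  \<comment> \<open>for \<open>r \<le> 1\<close> one has \<open>q r \<le> 12 / r\<close>, so \<open>h r \<le> K r\<^sup>2 - \<Lambda> r / 6\<close>, negative for \<open>r < \<Lambda> / (6 K)\<close>\<close>
  define a where "a = min 1 (\<Lambda>' / (12 * K))"
  have a: "0 < a" "a \<le> 1" "a \<le> \<Lambda>' / (12 * K)" using \<Lambda>pos K by (auto simp: a_def)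
  have neg: "h_fun L K r < 0" if r: "0 < r" "r \<le> a" for r
  proof -
    have "r^4 \<le> 1" "r^2 \<le> 1" using r a by (auto intro!: power_le_one)
    then have "p r \<le> 6 / r" using r by (simp add: p_def divide_right_mono)
    then have "q r \<le> 12 / r" using q(2)[OF r(1)] by simp
    moreover have "q r > 0" using q(1)[OF r(1)] p2[OF r(1)] by linarith
    ultimately have "2 * \<Lambda>' / (12 / r) \<le> 2 * \<Lambda>' / q r"
      using \<Lambda>pos r by (intro divide_left_mono) auto
    then have 1: "\<Lambda>' * r / 6 \<le> 2 * \<Lambda>' / q r" by simp
    have "K * r^2 / (1 + r^2) \<le> K * r^2" using K r by (simp add: field_simps add_pos_pos)
    also have "\<dots> < \<Lambda>' * r / 6"
    proof -
      have "K * r \<le> K * (\<Lambda>' / (12 * K))" using r a K by (intro mult_left_mono) auto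
      also have "\<dots> = \<Lambda>' / 12" using K by simp
      also have "\<dots> < \<Lambda>' / 6" using \<Lambda>pos by simp
      finally have "K * r * r < \<Lambda>' / 6 * r" using r by (intro mult_strict_right_mono)
      then show ?thesis by (simp add: power2_eq_square mult.assoc)
    qed
    finally show ?thesis using 1 hq[OF r(1)] by linarith
  qed
  \<comment> \<open>for \<open>r \<ge> 1\<close> one has \<open>q r \<ge> r\<close> and \<open>r\<^sup>2 / (1 + r\<^sup>2) \<ge> 1/2\<close>, so \<open>h r \<ge> K / 2 - 2 \<Lambda> / r\<close>\<close>
  define b where "b = max 1 (4 * \<Lambda>' / K)"
  have b: "1 \<le> b" "4 * \<Lambda>' / K \<le> b" by (auto simp: b_def)
  have pos: "0 \<le> h_fun L K b"
  proof -
    have "b * b \<le> b^4 + 3 * b^2 + 2" by (simp add: power2_eq_square[symmetric])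
    then have "b \<le> p b" using b by (simp add: p_def field_simps)
    then have "b \<le> q b" using q(1)[of b] b by simp
    then have "2 * \<Lambda>' / q b \<le> 2 * \<Lambda>' / b" using \<Lambda>pos b by (intro divide_left_mono) auto
    also have "\<dots> \<le> K / 2" using b K by (simp add: field_simps)
    also have "K / 2 \<le> K * b^2 / (1 + b^2)"
    proof -
      have "1 \<le> b^2" using b by (simp add: one_le_power)
      then have "1 / 2 \<le> b^2 / (1 + b^2)" by (simp add: field_simps)
      from mult_left_mono[OF this, of K] K show ?thesis by simp
    qed
    finally show ?thesis using hq[of b] b by simp
  qed
  have ab: "a \<le> b" using a b by linarith
  have cont: "continuous_on {a..} (h_fun L K)"
    unfolding h_fun_def using a(1)
    by (intro continuous_intros) (auto simp: add_nonneg_eq_0_iff)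
  define Z where "Z = {r \<in> {a..b}. h_fun L K r = 0}"
  have "\<exists>r\<ge>a. r \<le> b \<and> h_fun L K r = 0"
    using neg[of a] a pos ab cont by (intro IVT') (auto intro: continuous_on_subset)
  then have "Z \<noteq> {}" by (auto simp: Z_def)
  moreover have "closed Z" unfolding Z_def
    by (intro continuous_closed_preimage_constant continuous_on_subset[OF cont]) auto
  then have "compact Z" unfolding compact_eq_bounded_closed
    by (auto simp: Z_def intro: bounded_subset[of "{a..b}"])
  ultimately obtain \<beta> where \<beta>: "\<beta> \<in> Z" and min: "\<And>r. r \<in> Z \<Longrightarrow> \<beta> \<le> r"
    using compact_attains_inf by metis
  have "h_fun L K r < 0" if r: "0 < r" "r < \<beta>" for r
  proof (rule ccontr)
    assume nn: "\<not> h_fun L K r < 0"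
    then have "a < r" using neg[of r] r by force
    have "\<exists>s\<ge>a. s \<le> r \<and> h_fun L K s = 0"
      using neg[of a] a nn \<open>a < r\<close> cont by (intro IVT') (auto intro: continuous_on_subset)
    then show False using min r \<beta> by (force simp: Z_def)
  qed
  moreover have "0 < \<beta>" "h_fun L K \<beta> = 0" using \<beta> a by (auto simp: Z_def)
  ultimately show ?thesis by blast
qed

section \<open>Convex functions with Lipschitz gradient\<close>

lemma DERIV_along_line:
  fixes F :: "'a::real_inner \<Rightarrow> real"
  assumes "\<And>x. GDERIV F x :> G x"
  shows "((\<lambda>t. F (x + t *\<^sub>R d)) has_real_derivative (G (x + t *\<^sub>R d) \<bullet> d)) (at t)"
proof -
  have "((\<lambda>t. x + t *\<^sub>R d) has_derivative (\<lambda>s. s *\<^sub>R d)) (at t)"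
    by (auto intro!: derivative_eq_intros)
  moreover have "(F has_derivative (\<lambda>h. h \<bullet> G (x + t *\<^sub>R d))) (at (x + t *\<^sub>R d))"
    using assms by (simp add: gderiv_def)
  ultimately have "((\<lambda>t. F (x + t *\<^sub>R d)) has_derivative (\<lambda>s. (s *\<^sub>R d) \<bullet> G (x + t *\<^sub>R d))) (at t)"
    by (rule has_derivative_compose)
  then show ?thesis
    by (simp add: has_field_derivative_def inner_commute mult_commute_abs)
qed

lemma convex_gradient_inequality:
  fixes F :: "'a::real_inner \<Rightarrow> real"
  assumes conv: "convex_on UNIV F" and grad: "\<And>x. GDERIV F x :> G x"
  shows "F x + G x \<bullet> (y - x) \<le> F y"
proof -
  let ?\<phi> = "\<lambda>t. F (x + t *\<^sub>R (y - x))"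
  have "convex_on UNIV ?\<phi>"
  proof (rule convex_onI)
    fix t a b :: real
    assume t: "0 < t" "t < 1"
    have "x + ((1 - t) *\<^sub>R a + t *\<^sub>R b) *\<^sub>R (y - x) = (1 - t) *\<^sub>R (x + a *\<^sub>R (y - x)) + t *\<^sub>R (x + b *\<^sub>R (y - x))"
      by (simp add: algebra_simps)
    then show "?\<phi> ((1 - t) *\<^sub>R a + t *\<^sub>R b) \<le> (1 - t) * ?\<phi> a + t * ?\<phi> b"
      using convex_onD[OF conv, of t "x + a *\<^sub>R (y - x)" "x + b *\<^sub>R (y - x)"] t by simp
  qed simp
  moreover have "(?\<phi> has_real_derivative G x \<bullet> (y - x)) (at 0)"
    using DERIV_along_line[OF grad, of x "y - x" 0] by simp
  ultimately have "G x \<bullet> (y - x) * (1 - 0) \<le> ?\<phi> 1 - ?\<phi> 0"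
    by (intro convex_on_imp_above_tangent[where A = UNIV]) auto
  then show ?thesis by simp
qed

lemma descent_lemma:
  fixes F :: "'a::real_inner \<Rightarrow> real"
  assumes grad: "\<And>x. GDERIV F x :> G x" and lip: "K-lipschitz_on UNIV G"
  shows "F (x + d) \<le> F x + G x \<bullet> d + K / 2 * (d \<bullet> d)"
proof -
  let ?\<phi> = "\<lambda>t. F (x + t *\<^sub>R d) - t * (G x \<bullet> d) - K / 2 * t\<^sup>2 * (d \<bullet> d)"
  have "?\<phi> 1 \<le> ?\<phi> 0"
  proof (rule DERIV_nonpos_imp_nonincreasing[of 0 1 ?\<phi>])
    fix t :: real
    assume t: "0 \<le> t" "t \<le> 1"
    have "(?\<phi> has_real_derivative (G (x + t *\<^sub>R d) \<bullet> d - G x \<bullet> d - K * t * (d \<bullet> d))) (at t)"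
      by (rule derivative_eq_intros DERIV_along_line[OF grad] refl | simp)+
    moreover have "G (x + t *\<^sub>R d) \<bullet> d - G x \<bullet> d - K * t * (d \<bullet> d) \<le> 0"
    proof -
      have "G (x + t *\<^sub>R d) \<bullet> d - G x \<bullet> d = (G (x + t *\<^sub>R d) - G x) \<bullet> d"
        by (simp add: inner_diff_left)
      also have "\<dots> \<le> norm (G (x + t *\<^sub>R d) - G x) * norm d" by (rule norm_cauchy_schwarz)
      also have "\<dots> \<le> (K * norm (t *\<^sub>R d)) * norm d"
        using lipschitz_onD[OF lip, of "x + t *\<^sub>R d" x]
        by (intro mult_right_mono) (auto simp: dist_norm)
      also have "\<dots> = K * t * (d \<bullet> d)"
        using t by (simp add: power2_norm_eq_inner[symmetric] power2_eq_square)
      finally show ?thesis by simp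
    qed
    ultimately show "\<exists>D. (?\<phi> has_real_derivative D) (at t) \<and> D \<le> 0" by blast
  qed simp
  then show ?thesis by simp
qed

text \<open>The lower bound by the tangent plane at \<open>x\<close> is applied at the point reached from \<open>y\<close> by a gradient
  step of length \<open>1 / K\<close> for \<open>F - G x\<close>; by the descent lemma this step gains the quadratic term.\<close>
lemma convex_gradient_inequality_strong:
  fixes F :: "'a::real_inner \<Rightarrow> real"
  assumes conv: "convex_on UNIV F" and grad: "\<And>x. GDERIV F x :> G x"
    and lip: "K-lipschitz_on UNIV G" and K: "0 < K"
  shows "F x + G x \<bullet> (y - x) + (G y - G x) \<bullet> (G y - G x) / (2 * K) \<le> F y"
proof -
  define e where "e = G y - G x"
  let ?u = "y + (- (1 / K)) *\<^sub>R e"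
  have "F x + G x \<bullet> (?u - x) \<le> F ?u" by (rule convex_gradient_inequality[OF conv grad])
  also have "F ?u \<le> F y + G y \<bullet> ((- (1 / K)) *\<^sub>R e)
      + K / 2 * (((- (1 / K)) *\<^sub>R e) \<bullet> ((- (1 / K)) *\<^sub>R e))"
    by (rule descent_lemma[OF grad lip])
  also have "K / 2 * (((- (1 / K)) *\<^sub>R e) \<bullet> ((- (1 / K)) *\<^sub>R e)) = e \<bullet> e / (2 * K)"
    using K by (simp add: field_simps)
  finally have "F x + G x \<bullet> (y - x) + (G y - G x) \<bullet> e / K - e \<bullet> e / (2 * K) \<le> F y"
    by (simp add: inner_diff_right inner_diff_left inner_add_right diff_divide_distrib)
  then show ?thesis by (simp add: e_def[symmetric] field_simps)
qed

text \<open>The Baillon--Haddad theorem: the sum of the strengthened gradient inequality and its copy with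
  \<open>x\<close> and \<open>y\<close> exchanged.\<close>
lemma gradient_cocoercive:
  fixes F :: "'a::real_inner \<Rightarrow> real"
  assumes conv: "convex_on UNIV F" and grad: "\<And>x. GDERIV F x :> G x"
    and lip: "K-lipschitz_on UNIV G" and K: "0 < K"
  shows "(G x - G y) \<bullet> (G x - G y) / K \<le> (x - y) \<bullet> (G x - G y)"
proof -
  have "(G y - G x) \<bullet> (G y - G x) = (G x - G y) \<bullet> (G x - G y)"
    by (simp add: inner_diff_left inner_diff_right inner_commute)
  then show ?thesis
    using convex_gradient_inequality_strong[OF conv grad lip K, of x y]
      convex_gradient_inequality_strong[OF conv grad lip K, of y x]
    by (simp add: inner_diff_left inner_diff_right inner_commute field_simps)
qed

lemma minimizer_on_subspace_gradient:
  fixes F :: "'a::real_inner \<Rightarrow> real"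
  assumes grad: "\<And>x. GDERIV F x :> G x" and min: "\<And>t. F x \<le> F (x + t *\<^sub>R c)"
  shows "c \<bullet> G x = 0"
proof -
  have "((\<lambda>t. F (x + t *\<^sub>R c)) has_real_derivative G x \<bullet> c) (at 0)"
    using DERIV_along_line[OF grad, of x c 0] by simp
  then have "G x \<bullet> c = 0" by (rule DERIV_local_min[of _ _ _ 1]) (use min in auto)
  then show ?thesis by (simp add: inner_commute)
qed

section \<open>The dissipation estimate\<close>

text \<open>The right-hand side is \<open>2 a (y \<bullet> B y) + 2 b (y \<bullet> B w + w \<bullet> B y) + 2 c (w \<bullet> B w)\<close> for a symmetric
  matrix with entries \<open>a, b, c\<close>, trace \<open>p / 2\<close> and determinant \<open>1/4\<close>, and \<open>m\<close> is its smaller eigenvalue.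
  Subtracting \<open>m\<close> from the diagonal leaves a matrix of rank one, so the difference of the two sides
  is the form of \<open>B\<close> at the single vector \<open>\<rho> y + \<sigma> w\<close>, up to a positive factor.\<close>
lemma quadratic_form_lower_bound:
  fixes B :: "'a::real_inner \<Rightarrow> 'a" and y w :: 'a and \<beta> :: real
  assumes lin: "linear B" and psd: "\<And>v. 0 \<le> v \<bullet> B v" and \<beta>: "0 < \<beta>"
  defines "p \<equiv> (\<beta>^4 + 3 * \<beta>^2 + 2) / \<beta>"
  defines "m \<equiv> (p - sqrt (p\<^sup>2 - 4)) / 4"
  shows "m * (2 * (y \<bullet> B y) + 2 * (w \<bullet> B w)) \<le>
      (\<beta>^4 + 2 * \<beta>^2 + 2) / \<beta> * (y \<bullet> B y) + (1 + \<beta>\<^sup>2) * (y \<bullet> B w + w \<bullet> B y) + \<beta> * (w \<bullet> B w)"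
    and "0 < m"
proof -
  define a where "a = (\<beta>^4 + 2 * \<beta>^2 + 2) / (2 * \<beta>)"
  define c where "c = \<beta> / 2"
  define b where "b = (1 + \<beta>\<^sup>2) / 2"
  define s where "s = sqrt (p\<^sup>2 - 4)"
  have pac: "p = 2 * (a + c)" using \<beta> by (simp add: p_def a_def c_def field_simps power2_eq_square)
  have det: "a * c - b\<^sup>2 = 1 / 4"
    using \<beta> by (simp add: a_def b_def c_def field_simps power2_eq_square power4_eq_xxxx)
  have pos: "0 < a" "0 < c" "0 < b" using \<beta> by (auto simp: a_def b_def c_def add_nonneg_pos add_pos_nonneg)
  have "p\<^sup>2 - 4 = 4 * ((a - c)\<^sup>2 + 4 * b\<^sup>2)"
    using det by (simp add: pac power2_eq_square algebra_simps)
  then have p4: "0 \<le> p\<^sup>2 - 4" by simp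
  then have s2: "s\<^sup>2 = p\<^sup>2 - 4" by (simp add: s_def)
  have s0: "0 \<le> s" using p4 by (simp add: s_def)
  have "s < p"
  proof (rule power2_less_imp_less)
    show "s\<^sup>2 < p\<^sup>2" by (simp add: s2)
    show "0 \<le> p" using pos by (simp add: pac)
  qed
  then show "0 < m" by (simp add: m_def s_def)
  have m: "m = (p - s) / 4" by (simp add: m_def s_def)
  have prod: "(a - m) * (c - m) = b\<^sup>2"
  proof -
    have "(a - m) * (c - m) = a * c - (p / 2) * m + m\<^sup>2" by (simp add: pac power2_eq_square algebra_simps)
    also have "\<dots> = a * c - (p\<^sup>2 - s\<^sup>2) / 16" by (simp add: m power2_eq_square field_simps)
    finally show ?thesis using det s2 by simp
  qed
  have "(a - m) + (c - m) = s / 2" unfolding m pac by (simp add: field_simps)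
  then have nn: "0 < a - m" "0 < c - m"
  proof -
    have "0 < (a - m) * (c - m)" using prod pos by simp
    then show "0 < a - m" "0 < c - m"
      using \<open>(a - m) + (c - m) = s / 2\<close> s0 by (auto simp: zero_less_mult_iff)
  qed
  define \<rho> where "\<rho> = sqrt (a - m)"
  define \<sigma> where "\<sigma> = sqrt (c - m)"
  have \<rho>: "\<rho> * \<rho> = a - m" "\<sigma> * \<sigma> = c - m" using nn by (auto simp: \<rho>_def \<sigma>_def)
  have \<rho>\<sigma>: "\<rho> * \<sigma> = b" using pos by (simp add: \<rho>_def \<sigma>_def real_sqrt_mult[symmetric] prod)
  have "0 \<le> (\<rho> *\<^sub>R y + \<sigma> *\<^sub>R w) \<bullet> B (\<rho> *\<^sub>R y + \<sigma> *\<^sub>R w)" by (rule psd)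
  also have "\<dots> = (\<rho> * \<rho>) * (y \<bullet> B y) + (\<rho> * \<sigma>) * (y \<bullet> B w + w \<bullet> B y) + (\<sigma> * \<sigma>) * (w \<bullet> B w)"
    using lin by (simp add: linear_add linear_scale inner_add_left inner_add_right algebra_simps)
  finally have "m * (y \<bullet> B y + w \<bullet> B w) \<le>
      a * (y \<bullet> B y) + b * (y \<bullet> B w + w \<bullet> B y) + c * (w \<bullet> B w)"
    unfolding \<rho> \<rho>\<sigma> by (simp add: algebra_simps)
  then have "2 * (m * (y \<bullet> B y + w \<bullet> B w)) \<le>
      2 * (a * (y \<bullet> B y) + b * (y \<bullet> B w + w \<bullet> B y) + c * (w \<bullet> B w))" by simp
  also have "\<dots> = (2 * a) * (y \<bullet> B y) + (2 * b) * (y \<bullet> B w + w \<bullet> B y) + (2 * c) * (w \<bullet> B w)"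
    by (simp add: algebra_simps)
  also have "2 * a = (\<beta>^4 + 2 * \<beta>^2 + 2) / \<beta>" using \<beta> by (simp add: a_def field_simps)
  also have "2 * b = 1 + \<beta>\<^sup>2" by (simp add: b_def)
  also have "2 * c = \<beta>" by (simp add: c_def)
  finally show "m * (2 * (y \<bullet> B y) + 2 * (w \<bullet> B w)) \<le>
      (\<beta>^4 + 2 * \<beta>^2 + 2) / \<beta> * (y \<bullet> B y) + (1 + \<beta>\<^sup>2) * (y \<bullet> B w + w \<bullet> B y) + \<beta> * (w \<bullet> B w)"
    by (simp add: algebra_simps)
qed

text \<open>Here \<open>y'\<close> and \<open>B y\<close> are the velocities of \<open>y\<close> and \<open>w\<close>, so the left-hand side is the derivative of
  \<open>(\<parallel>y\<parallel>\<^sup>2 + \<parallel>\<beta> y + w\<parallel>\<^sup>2) / 2\<close>. Half of the cocoercivity bound pays for the cross term \<open>\<beta> (w \<bullet> g)\<close>;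
  the other half is kept, because the convergence proof needs dissipation in \<open>g\<close> as well. The
  spectral gap is needed only at \<open>w\<close>.\<close>
lemma lyapunov_derivative_bound:
  fixes B :: "'a::real_inner \<Rightarrow> 'a" and y w g :: 'a and \<beta> \<Lambda> K :: real
  assumes lin: "linear B" and psd: "\<And>v. 0 \<le> v \<bullet> B v" and \<beta>: "0 < \<beta>" and K: "0 < K"
    and gap: "\<Lambda> * (w \<bullet> w) \<le> 2 * (w \<bullet> B w)"
    and coco: "g \<bullet> g / K \<le> y \<bullet> g"
  defines "p \<equiv> (\<beta>^4 + 3 * \<beta>^2 + 2) / \<beta>"
  defines "m \<equiv> (p - sqrt (p\<^sup>2 - 4)) / 4"
  defines "h \<equiv> 1/2 * \<Lambda> * (- p + sqrt (p\<^sup>2 - 4)) + K * \<beta>^2 / (1 + \<beta>^2)"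
  defines "y' \<equiv> - g - ((\<beta>\<^sup>2 + 2) / \<beta>) *\<^sub>R B y - B w"
  shows "y \<bullet> y' + (\<beta> *\<^sub>R y + w) \<bullet> (\<beta> *\<^sub>R y' + B y)
    \<le> - (2 * m * (y \<bullet> B y) + (- h / 2) * (w \<bullet> w) + (1 + \<beta>\<^sup>2) / (2 * K) * (g \<bullet> g))"
proof -
  define s where "s = 1 + \<beta>\<^sup>2"
  have s: "0 < s" by (simp add: s_def add_pos_nonneg)
  have m: "0 < m" unfolding m_def p_def by (rule quadratic_form_lower_bound(2)[OF lin psd \<beta>])
  have "y \<bullet> y' + (\<beta> *\<^sub>R y + w) \<bullet> (\<beta> *\<^sub>R y' + B y)
      = - ((\<beta>^4 + 2 * \<beta>^2 + 2) / \<beta> * (y \<bullet> B y) + s * (y \<bullet> B w + w \<bullet> B y) + \<beta> * (w \<bullet> B w))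
        - s * (y \<bullet> g) - \<beta> * (w \<bullet> g)"
    using \<beta> unfolding y'_def s_def
    by (simp add: inner_add_left inner_add_right inner_diff_right field_simps power2_eq_square power4_eq_xxxx)
  also have "\<dots> \<le> - (m * (2 * (y \<bullet> B y) + 2 * (w \<bullet> B w))) - s * (g \<bullet> g / K) - \<beta> * (w \<bullet> g)"
    using quadratic_form_lower_bound(1)[OF lin psd \<beta>, of y w] mult_left_mono[OF coco, of s] s
    unfolding m_def p_def s_def by linarith
  also have "\<dots> \<le> - (m * (2 * (y \<bullet> B y) + \<Lambda> * (w \<bullet> w))) - s * (g \<bullet> g / K)
      + (K * \<beta>\<^sup>2 / (2 * s) * (w \<bullet> w) + s / (2 * K) * (g \<bullet> g))"
  proof -
    \<comment> \<open>Young's inequality for \<open>\<beta> (w \<bullet> g)\<close>, with weights that leave half of \<open>s * (g \<bullet> g) / K\<close>\<close>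
    have "0 \<le> (norm ((K * \<beta> / s) *\<^sub>R w + g))\<^sup>2" by simp
    also have "\<dots> = (K * \<beta> / s)\<^sup>2 * (w \<bullet> w) + 2 * (K * \<beta> / s) * (w \<bullet> g) + g \<bullet> g"
      unfolding power2_norm_eq_inner
      by (simp add: inner_add_left inner_add_right inner_commute power2_eq_square)
    finally have "0 \<le> s / (2 * K) * ((K * \<beta> / s)\<^sup>2 * (w \<bullet> w) + 2 * (K * \<beta> / s) * (w \<bullet> g) + g \<bullet> g)"
      using s K by (intro mult_nonneg_nonneg) auto
    also have "\<dots> = K * \<beta>\<^sup>2 / (2 * s) * (w \<bullet> w) + \<beta> * (w \<bullet> g) + s / (2 * K) * (g \<bullet> g)"
      using s K by (simp add: field_simps power2_eq_square)
    finally have 1: "- \<beta> * (w \<bullet> g) \<le> K * \<beta>\<^sup>2 / (2 * s) * (w \<bullet> w) + s / (2 * K) * (g \<bullet> g)" by simp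
    have "m * (2 * (y \<bullet> B y) + \<Lambda> * (w \<bullet> w)) \<le> m * (2 * (y \<bullet> B y) + 2 * (w \<bullet> B w))"
      using gap m by (intro mult_left_mono) auto
    with 1 show ?thesis by linarith
  qed
  also have "\<dots> = - (2 * m * (y \<bullet> B y) + (- h / 2) * (w \<bullet> w) + s / (2 * K) * (g \<bullet> g))"
  proof -
    have "- h / 2 = m * \<Lambda> - K * \<beta>\<^sup>2 / (2 * s)"
    proof -
      have "h = - 2 * (m * \<Lambda>) + K * \<beta>\<^sup>2 / s"
      proof -
        have "1/2 * \<Lambda> * (- p + sqrt (p\<^sup>2 - 4)) = - 2 * (m * \<Lambda>)"
          by (simp add: m_def field_simps)
        then show ?thesis unfolding h_def s_def by simp
      qed
      moreover have "K * \<beta>\<^sup>2 / (2 * s) = K * \<beta>\<^sup>2 / s / 2" by simp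
      ultimately show ?thesis by linarith
    qed
    moreover have "s * (g \<bullet> g / K) = 2 * (s / (2 * K) * (g \<bullet> g))" using K by simp
    ultimately show ?thesis by (simp add: algebra_simps)
  qed
  finally show ?thesis by (simp add: s_def)
qed

lemma derivative_bound_imp_decrease:
  fixes V :: "real \<Rightarrow> real"
  assumes "a \<le> b" and der: "\<And>t. a \<le> t \<Longrightarrow> \<exists>D. (V has_real_derivative D) (at t within {a..}) \<and> D \<le> c"
  shows "V b \<le> V a + c * (b - a)"
proof -
  obtain V' where V': "\<And>t. a \<le> t \<Longrightarrow> (V has_real_derivative V' t) (at t within {a..}) \<and> V' t \<le> c"
    using der by metis
  have "\<exists>t\<in>{a..b}. V b - V a = V' t * (b - a)"
  proof (rule mvt_very_simple[OF \<open>a \<le> b\<close>])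
    fix t assume "a \<le> t" "t \<le> b"
    then show "(V has_derivative (*) (V' t)) (at t within {a..b})"
      using V'[of t] unfolding has_field_derivative_def
      by (meson atLeastAtMost_iff atLeast_iff has_derivative_subset subsetI)
  qed
  then obtain t where "t \<in> {a..b}" "V b - V a = V' t * (b - a)" by blast
  then show ?thesis using V'[of t] \<open>a \<le> b\<close> mult_right_mono[of "V' t" c "b - a"] by auto
qed

section \<open>Convergence of the saddle-point flow\<close>

lemma has_real_derivative_half_inner_self:
  fixes u :: "real \<Rightarrow> 'a::real_inner"
  assumes "(u has_vector_derivative u') (at t within S)"
  shows "((\<lambda>t. u t \<bullet> u t / 2) has_real_derivative u t \<bullet> u') (at t within S)"
  using assms unfolding has_vector_derivative_def has_field_derivative_def
  by (auto intro!: derivative_eq_intros simp: inner_commute fun_eq_iff)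

text \<open>The set of equilibria sharing the multiplier \<open>zs\<close> consists of the points \<open>l\<close> with \<open>B l = 0\<close> and
  \<open>G l = G xs\<close>. The Lyapunov function \<open>V l\<close> can be based at any of them, whereas its dissipation rate
  \<open>D\<close> does not depend on \<open>l\<close>. This replaces the invariance principle: a limit point along times of
  vanishing dissipation is itself a legitimate base point, and \<open>V l\<close> controls the distance to it.\<close>
lemma saddle_flow_converges:
  fixes B :: "'a::euclidean_space \<Rightarrow> 'a" and x z :: "real \<Rightarrow> 'a"
  assumes lin: "linear B" and psd: "\<And>v. 0 \<le> v \<bullet> B v" and null: "\<And>v. v \<bullet> B v = 0 \<Longrightarrow> B v = 0"
    and gap: "\<And>w. (\<And>c. B c = 0 \<Longrightarrow> c \<bullet> w = 0) \<Longrightarrow> \<Lambda> * (w \<bullet> w) \<le> 2 * (w \<bullet> B w)"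
    and conv: "convex_on UNIV F" and grad: "\<And>x. GDERIV F x :> G x"
    and lip: "K-lipschitz_on UNIV G" and K: "0 < K" and \<beta>: "0 < \<beta>"
    and hneg: "1/2 * \<Lambda> * (- ((\<beta>^4 + 3 * \<beta>^2 + 2) / \<beta>)
        + sqrt (((\<beta>^4 + 3 * \<beta>^2 + 2) / \<beta>)\<^sup>2 - 4)) + K * \<beta>^2 / (1 + \<beta>^2) < 0"
    and x': "\<And>t. 0 \<le> t \<Longrightarrow> (x has_vector_derivative
        - G (x t) - ((\<beta>\<^sup>2 + 2) / \<beta>) *\<^sub>R B (x t) - B (z t)) (at t within {0..})"
    and z': "\<And>t. 0 \<le> t \<Longrightarrow> (z has_vector_derivative B (x t)) (at t within {0..})"
    and xs: "B xs = 0" "\<And>c. B c = 0 \<Longrightarrow> c \<bullet> G xs = 0"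
  shows "\<exists>l. B l = 0 \<and> G l = G xs \<and> (x \<longlongrightarrow> l) at_top"
proof -
  obtain zs where zs: "B zs = - G xs" and zs0: "\<And>c. B c = 0 \<Longrightarrow> c \<bullet> (z 0 - zs) = 0"
    using ex_equilibrium_component[OF lin null, of "- G xs" "z 0"] xs(2) by auto
  define w where "w t = z t - zs" for t
  define g where "g t = G (x t) - G xs" for t
  have kerorth: "c \<bullet> B v = 0" if "B c = 0" for c v
    using psd_kernel_orthogonal_range[OF lin psd that] .
  have worth: "c \<bullet> w t = 0" if c: "B c = 0" and t: "0 \<le> t" for c t
  proof -
    have "\<exists>k. \<forall>t\<in>{0..}. c \<bullet> w t = k"
    proof (rule has_field_derivative_zero_constant)
      fix t :: real assume "t \<in> {0..}"
      then have "((\<lambda>t. c \<bullet> w t) has_vector_derivative c \<bullet> B (x t)) (at t within {0..})"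
        unfolding w_def using z'[of t]
        by (intro bounded_linear.has_vector_derivative[OF bounded_linear_inner_right]) (auto intro!: derivative_eq_intros)
      then show "((\<lambda>t. c \<bullet> w t) has_real_derivative 0) (at t within {0..})"
        by (simp add: has_real_derivative_iff_has_vector_derivative kerorth[OF c])
    qed simp
    then show ?thesis using zs0[OF c] t by (auto simp: w_def)
  qed
  define p where "p = (\<beta>^4 + 3 * \<beta>^2 + 2) / \<beta>"
  define m where "m = (p - sqrt (p\<^sup>2 - 4)) / 4"
  define h where "h = 1/2 * \<Lambda> * (- p + sqrt (p\<^sup>2 - 4)) + K * \<beta>^2 / (1 + \<beta>^2)"
  have m: "0 < m" unfolding m_def p_def by (rule quadratic_form_lower_bound(2)[OF lin psd \<beta>])
  have h: "h < 0" using hneg by (simp add: h_def p_def)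
  have sK: "0 < (1 + \<beta>\<^sup>2) / (2 * K)" using K by (simp add: add_pos_nonneg)
  define D where "D t = 2 * m * (x t \<bullet> B (x t)) + (- h / 2) * (w t \<bullet> w t)
      + (1 + \<beta>\<^sup>2) / (2 * K) * (g t \<bullet> g t)" for t
  have D_terms: "0 \<le> 2 * m * (x t \<bullet> B (x t))" "0 \<le> (- h / 2) * (w t \<bullet> w t)"
      "0 \<le> (1 + \<beta>\<^sup>2) / (2 * K) * (g t \<bullet> g t)" for t
    using m psd h sK by (auto intro!: mult_nonneg_nonneg mult_nonpos_nonneg simp del: times_divide_eq_left)
  have D_ge: "2 * m * (x t \<bullet> B (x t)) \<le> D t" "(- h / 2) * (w t \<bullet> w t) \<le> D t"
      "(1 + \<beta>\<^sup>2) / (2 * K) * (g t \<bullet> g t) \<le> D t" for t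
    unfolding D_def using D_terms[of t] by linarith+
  have D0: "0 \<le> D t" for t using D_terms[of t] by (simp add: D_def)
  define V where "V l t = (x t - l) \<bullet> (x t - l) / 2
      + (\<beta> *\<^sub>R (x t - l) + w t) \<bullet> (\<beta> *\<^sub>R (x t - l) + w t) / 2" for l t
  have V_ge: "(norm (x t - l))\<^sup>2 \<le> 2 * V l t" for l t
    by (simp add: V_def power2_norm_eq_inner)
  have V': "\<exists>d. (V l has_real_derivative d) (at t within {0..}) \<and> d \<le> - D t"
    if l: "B l = 0" "G l = G xs" and t: "0 \<le> t" for l t
  proof -
    define y where "y = x t - l"
    define y' where "y' = - g t - ((\<beta>\<^sup>2 + 2) / \<beta>) *\<^sub>R B y - B (w t)"
    have By: "B y = B (x t)" using lin l by (simp add: y_def linear_diff)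
    have "y' = - G (x t) - ((\<beta>\<^sup>2 + 2) / \<beta>) *\<^sub>R B (x t) - B (z t)"
      using lin zs by (simp add: y'_def By g_def w_def linear_diff)
    then have 1: "((\<lambda>t. x t - l) has_vector_derivative y') (at t within {0..})"
      using x'[OF t] by (auto intro!: derivative_eq_intros)
    have "(w has_vector_derivative B y) (at t within {0..})"
      unfolding w_def By[unfolded y_def] y_def using z'[OF t] by (auto intro!: derivative_eq_intros)
    then have "((\<lambda>t. \<beta> *\<^sub>R (x t - l) + w t) has_vector_derivative \<beta> *\<^sub>R y' + B y) (at t within {0..})"
      by (intro has_vector_derivative_add 1
          bounded_linear.has_vector_derivative[OF bounded_linear_scaleR_right])
    from DERIV_add[OF has_real_derivative_half_inner_self[OF 1] has_real_derivative_half_inner_self[OF this]]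
    have "(V l has_real_derivative y \<bullet> y' + (\<beta> *\<^sub>R y + w t) \<bullet> (\<beta> *\<^sub>R y' + B y)) (at t within {0..})"
      unfolding V_def y_def .
    moreover have "y \<bullet> B y = x t \<bullet> B (x t)"
      unfolding By using kerorth[OF l(1)] by (simp add: y_def inner_diff_left)
    moreover have "g t \<bullet> g t / K \<le> y \<bullet> g t"
      using gradient_cocoercive[OF conv grad lip K, of "x t" l] by (simp add: g_def y_def l)
    ultimately show ?thesis
      using lyapunov_derivative_bound[OF lin psd \<beta> K gap[OF worth[OF _ t]], of "g t" y]
      unfolding D_def h_def m_def p_def y'_def by auto
  qed
  have V_decrease: "V l t \<le> V l s + c * (t - s)"
    if l: "B l = 0" "G l = G xs" and st: "0 \<le> s" "s \<le> t" and c: "\<And>t. s \<le> t \<Longrightarrow> - D t \<le> c" for l s t c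
  proof (rule derivative_bound_imp_decrease[OF st(2)])
    fix t assume "s \<le> t"
    then obtain d where "(V l has_real_derivative d) (at t within {0..})" "d \<le> - D t"
      using V'[OF l, of t] st by auto
    then show "\<exists>d. (V l has_real_derivative d) (at t within {s..}) \<and> d \<le> c"
      using c[OF \<open>s \<le> t\<close>] st by (meson DERIV_subset atLeast_subset_iff order_trans)
  qed
  have V_mono: "V l t \<le> V l s" if "B l = 0" "G l = G xs" "0 \<le> s" "s \<le> t" for l s t
    using V_decrease[OF that, of 0] D0 by simp
  have V0: "0 \<le> V l t" for l t by (simp add: V_def)
  have "\<exists>t\<ge>real n. D t < 1 / (real n + 1)" for n
  proof (rule ccontr)
    assume "\<not> ?thesis"
    then have D: "1 / (real n + 1) \<le> D t" if "real n \<le> t" for t using that by (force simp: add.commute)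
    \<comment> \<open>a dissipation of at least \<open>1 / (n + 1)\<close> from time \<open>n\<close> on would bring \<open>V xs\<close> below \<open>0\<close> by this time\<close>
    let ?t = "real n + (real n + 1) * (V xs n + 1)"
    have "V xs ?t \<le> V xs n + (- 1 / (real n + 1)) * (?t - n)"
      using D V0[of xs n] by (intro V_decrease xs) (auto intro!: mult_nonneg_nonneg)
    also have "\<dots> = - 1" by simp
    finally show False using V0[of xs ?t] by simp
  qed
  then obtain T where T: "\<And>n. real n \<le> T n" "\<And>n. D (T n) < 1 / (real n + 1)"
    by metis
  have T0: "0 \<le> T n" for n using T(1)[of n] by linarith
  have "(\<lambda>n. 1 / (real n + 1)) \<longlonglongrightarrow> 0" using LIMSEQ_inverse_real_of_nat by (simp add: field_simps)
  then have DT: "(\<lambda>n. D (T n)) \<longlonglongrightarrow> 0"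
    by (rule tendsto_sandwich[OF always_eventually[rule_format, OF D0]
          always_eventually[rule_format, OF less_imp_le[OF T(2)]] tendsto_const])
  have "bounded (range (\<lambda>n. x (T n)))"
  proof (rule bounded_subset[OF bounded_cball])
    show "range (\<lambda>n. x (T n)) \<subseteq> cball xs (sqrt (2 * V xs 0))"
    proof safe
      fix n
      have "(norm (x (T n) - xs))\<^sup>2 \<le> 2 * V xs 0"
        using V_ge[of "T n" xs] V_mono[OF xs(1) refl order_refl T0[of n]] by linarith
      then show "x (T n) \<in> cball xs (sqrt (2 * V xs 0))"
        by (simp add: dist_norm norm_minus_commute real_le_rsqrt)
    qed
  qed
  then obtain l r where r: "strict_mono r" and xl: "((\<lambda>n. x (T n)) \<circ> r) \<longlonglongrightarrow> l"
    using bounded_imp_convergent_subsequence by blast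
  define \<tau> where "\<tau> = T \<circ> r"
  have \<tau>0: "0 \<le> \<tau> n" for n by (simp add: \<tau>_def T0)
  have x\<tau>: "(\<lambda>n. x (\<tau> n)) \<longlonglongrightarrow> l" using xl by (simp add: \<tau>_def o_def)
  have D\<tau>: "(\<lambda>n. D (\<tau> n)) \<longlonglongrightarrow> 0"
    using LIMSEQ_subseq_LIMSEQ[OF DT r] by (simp add: \<tau>_def o_def)
  have term_lim: "(\<lambda>n. q (\<tau> n)) \<longlonglongrightarrow> 0" if "0 < c" "\<And>t. 0 \<le> c * q t" "\<And>t. c * q t \<le> D t" for c q
  proof -
    have "(\<lambda>n. c * q (\<tau> n)) \<longlonglongrightarrow> 0"
      by (rule tendsto_sandwich[OF _ _ tendsto_const D\<tau>]) (use that in auto)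
    from tendsto_mult_left[OF this, of "1 / c"] show ?thesis using that by simp
  qed
  have lB: "B l = 0"
  proof -
    have "(\<lambda>n. x (\<tau> n) \<bullet> B (x (\<tau> n))) \<longlonglongrightarrow> 0"
      by (rule term_lim[OF _ D_terms(1) D_ge(1)]) (use m in simp)
    moreover have "(\<lambda>n. x (\<tau> n) \<bullet> B (x (\<tau> n))) \<longlonglongrightarrow> l \<bullet> B l"
      by (intro tendsto_inner x\<tau>
          bounded_linear.tendsto[OF linear_conv_bounded_linear[THEN iffD1, OF lin]])
    ultimately show ?thesis using null LIMSEQ_unique by blast
  qed
  have w\<tau>: "(\<lambda>n. w (\<tau> n)) \<longlonglongrightarrow> 0"
  proof -
    have "(\<lambda>n. w (\<tau> n) \<bullet> w (\<tau> n)) \<longlonglongrightarrow> 0"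
      by (rule term_lim[OF _ D_terms(2) D_ge(2)]) (use h in simp)
    from tendsto_real_sqrt[OF this] show ?thesis
      by (simp add: norm_eq_sqrt_inner[symmetric] tendsto_norm_zero_iff)
  qed
  have lG: "G l = G xs"
  proof -
    have "(\<lambda>n. g (\<tau> n) \<bullet> g (\<tau> n)) \<longlonglongrightarrow> 0"
      by (rule term_lim[OF sK D_terms(3) D_ge(3)])
    from tendsto_real_sqrt[OF this] have "(\<lambda>n. g (\<tau> n)) \<longlonglongrightarrow> 0"
      by (simp add: norm_eq_sqrt_inner[symmetric] tendsto_norm_zero_iff)
    moreover have "isCont G l"
      using lipschitz_on_continuous_on[OF lip] by (simp add: continuous_on_eq_continuous_at)
    then have "(\<lambda>n. G (x (\<tau> n))) \<longlonglongrightarrow> G l" using x\<tau> by (rule isCont_tendsto_compose)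
    then have "(\<lambda>n. g (\<tau> n)) \<longlonglongrightarrow> G l - G xs" unfolding g_def by (intro tendsto_intros)
    ultimately have "G l - G xs = 0" using LIMSEQ_unique by blast
    then show ?thesis by simp
  qed
  have V\<tau>: "(\<lambda>n. V l (\<tau> n)) \<longlonglongrightarrow> 0"
  proof -
    have "(\<lambda>n. V l (\<tau> n)) \<longlonglongrightarrow> (l - l) \<bullet> (l - l) / 2 + (\<beta> *\<^sub>R (l - l) + 0) \<bullet> (\<beta> *\<^sub>R (l - l) + 0) / 2"
      unfolding V_def by (intro tendsto_intros x\<tau> w\<tau>) auto
    then show ?thesis by simp
  qed
  have "(x \<longlongrightarrow> l) at_top"
  proof (rule tendstoI)
    fix e :: real
    assume e: "0 < e"
    have "\<forall>\<^sub>F n in sequentially. V l (\<tau> n) < e\<^sup>2 / 2"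
      using order_tendstoD(2)[OF V\<tau>, of "e\<^sup>2 / 2"] e by simp
    then obtain n where n: "V l (\<tau> n) < e\<^sup>2 / 2" by (auto simp: eventually_sequentially)
    have "dist (x t) l < e" if "\<tau> n \<le> t" for t
    proof -
      have "V l t \<le> V l (\<tau> n)" using that \<tau>0 by (intro V_mono lB lG)
      then have "(norm (x t - l))\<^sup>2 < e\<^sup>2" using V_ge[of t l] n by linarith
      then show ?thesis using e by (simp add: dist_norm power2_less_imp_less)
    qed
    then show "\<forall>\<^sub>F t in at_top. dist (x t) l < e" unfolding eventually_at_top_linorder by blast
  qed
  with lB lG show ?thesis by blast
qed

section \<open>The Laplacian of a weight-balanced digraph\<close>

lemma laplacian_mult_component:
  "(laplacian A *v v) $ i = (\<Sum>j\<in>UNIV. A $ i $ j * (v $ i - v $ j))"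
proof -
  have "(out_degree_matrix A *v v) $ i = (\<Sum>j\<in>UNIV. A $ i $ j) * v $ i"
    by (simp add: out_degree_matrix_def matrix_vector_mult_def if_distrib[of "\<lambda>a. a * _"]
        cong: if_cong)
  moreover have "(A *v v) $ i = (\<Sum>j\<in>UNIV. A $ i $ j * v $ j)"
    by (simp add: matrix_vector_mult_def)
  ultimately show ?thesis
    by (simp add: laplacian_def matrix_vector_mult_diff_rdistrib
        right_diff_distrib sum_subtractf sum_distrib_right)
qed

text \<open>Weight balance makes \<open>\<Sum>i j. a\<^sub>i\<^sub>j v\<^sub>i\<^sup>2\<close> and \<open>\<Sum>i j. a\<^sub>i\<^sub>j v\<^sub>j\<^sup>2\<close> equal, so the square can be completed
  although the adjacency matrix is not symmetric.\<close>
lemma laplacian_quadratic_form: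
  assumes "weight_balanced A"
  shows "v \<bullet> (laplacian A *v v) = (\<Sum>i\<in>UNIV. \<Sum>j\<in>UNIV. A $ i $ j * (v $ i - v $ j)\<^sup>2) / 2"
proof -
  have "(\<Sum>i\<in>UNIV. \<Sum>j\<in>UNIV. A $ i $ j * (v $ j)\<^sup>2) = (\<Sum>j\<in>UNIV. (\<Sum>i\<in>UNIV. A $ i $ j) * (v $ j)\<^sup>2)"
    by (subst sum.swap) (simp add: sum_distrib_right)
  also have "\<dots> = (\<Sum>i\<in>UNIV. \<Sum>j\<in>UNIV. A $ i $ j * (v $ i)\<^sup>2)"
    using assms by (simp add: weight_balanced_def sum_distrib_right[symmetric])
  finally have eq: "(\<Sum>i\<in>UNIV. \<Sum>j\<in>UNIV. A $ i $ j * (v $ j)\<^sup>2)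
      = (\<Sum>i\<in>UNIV. \<Sum>j\<in>UNIV. A $ i $ j * (v $ i)\<^sup>2)" .
  have "2 * (v \<bullet> (laplacian A *v v))
      = (\<Sum>i\<in>UNIV. \<Sum>j\<in>UNIV. 2 * (A $ i $ j * (v $ i * (v $ i - v $ j))))"
    by (simp add: inner_vec_def laplacian_mult_component sum_distrib_left mult.left_commute)
  also have "\<dots> = (\<Sum>i\<in>UNIV. \<Sum>j\<in>UNIV. A $ i $ j * (v $ i - v $ j)\<^sup>2
      + A $ i $ j * (v $ i)\<^sup>2 - A $ i $ j * (v $ j)\<^sup>2)"
    by (intro sum.cong refl) (simp add: power2_eq_square algebra_simps)
  also have "\<dots> = (\<Sum>i\<in>UNIV. \<Sum>j\<in>UNIV. A $ i $ j * (v $ i - v $ j)\<^sup>2)"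
    by (simp add: sum.distrib sum_subtractf eq)
  finally show ?thesis by simp
qed

lemma laplacian_consensus:
  assumes "\<And>i j. v $ i = v $ j"
  shows "laplacian A *v v = 0"
proof -
  have "A $ i $ j * (v $ i - v $ j) = 0" for i j using assms[of i j] by simp
  then show ?thesis by (simp only: vec_eq_iff laplacian_mult_component) simp
qed

lemma laplacian_psd:
  assumes "weighted_digraph E A" "weight_balanced A"
  shows "0 \<le> v \<bullet> (laplacian A *v v)"
proof -
  have "0 \<le> A $ i $ j" for i j
    using assms(1) by (metis order_refl less_imp_le weighted_digraph_def)
  then show ?thesis unfolding laplacian_quadratic_form[OF assms(2)] by (simp add: sum_nonneg)
qed

lemma laplacian_form_zero_imp_consensus:
  assumes wd: "weighted_digraph E A" and sc: "strongly_connected E" and wb: "weight_balanced A"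
    and zero: "v \<bullet> (laplacian A *v v) = 0"
  shows "v $ i = v $ j"
proof -
  have A0: "0 \<le> A $ i $ j" for i j using wd by (metis order_refl less_imp_le weighted_digraph_def)
  have "(\<Sum>i\<in>UNIV. \<Sum>j\<in>UNIV. A $ i $ j * (v $ i - v $ j)\<^sup>2) = 0"
    using zero unfolding laplacian_quadratic_form[OF wb] by simp
  then have "A $ i $ j * (v $ i - v $ j)\<^sup>2 = 0" for i j
    using A0 by (simp add: sum_nonneg_eq_0_iff sum_nonneg)
  then have edge: "v $ i = v $ j" if "(i, j) \<in> E" for i j
    using wd that by (metis eq_iff_diff_eq_0 less_irrefl mult_eq_0_iff power_eq_0_iff weighted_digraph_def)
  have "v $ i = v $ j" if "(i, j) \<in> E\<^sup>+" for i j
    using that by (induction rule: trancl_induct) (auto dest: edge)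
  then show ?thesis using sc by (cases "i = j") (auto simp: strongly_connected_def)
qed

section \<open>Lifting from the Laplacian to its Kronecker product\<close>

text \<open>The columns of a stacked vector, viewed as a matrix whose rows are its blocks. The operator
  \<open>M \<otimes> I\<close> acts on each layer separately as \<open>M\<close>, which reduces its properties to those of \<open>M\<close>.\<close>
definition layer :: "real^('n::finite \<times> 'd::finite) \<Rightarrow> 'd \<Rightarrow> real^'n" where
  "layer x k = (\<chi> i. x $ (i, k))"

lemma inner_layers: "x \<bullet> y = (\<Sum>k\<in>UNIV. layer x k \<bullet> layer y k)"
  unfolding layer_def inner_vec_def
  by (subst sum.swap) (simp add: UNIV_Times_UNIV[symmetric] sum.cartesian_product case_prod_beta del: UNIV_Times_UNIV)

lemma layer_kronecker:
  fixes M :: "real^'n^'n"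
  shows "layer ((M \<otimes>\<^sub>K mat 1) *v x) k = M *v layer x k"
proof -
  have "((M \<otimes>\<^sub>K mat 1) *v x) $ (i, k) = (\<Sum>j\<in>UNIV. M $ i $ j * x $ (j, k))" for i
    using arg_cong[OF block_laplacian_kronecker[of M x i], of "\<lambda>u. u $ k"]
    by (simp add: block_def)
  then show ?thesis by (simp add: layer_def vec_eq_iff matrix_vector_mult_def)
qed

lemma eq_0_iff_layers: "x = 0 \<longleftrightarrow> (\<forall>k. layer x k = 0)"
  by (auto simp: vec_eq_iff layer_def)

lemma kronecker_form:
  fixes M :: "real^'n^'n"
  shows "x \<bullet> ((M \<otimes>\<^sub>K mat 1) *v x) = (\<Sum>k\<in>UNIV. layer x k \<bullet> (M *v layer x k))"
  by (simp add: inner_layers layer_kronecker)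

lemma kronecker_psd:
  fixes M :: "real^'n^'n"
  assumes "\<And>v. 0 \<le> v \<bullet> (M *v v)"
  shows "0 \<le> x \<bullet> ((M \<otimes>\<^sub>K mat 1) *v x)"
  unfolding kronecker_form by (intro sum_nonneg assms)

lemma kronecker_null:
  fixes M :: "real^'n^'n"
  assumes psd: "\<And>v. 0 \<le> v \<bullet> (M *v v)" and null: "\<And>v. v \<bullet> (M *v v) = 0 \<Longrightarrow> M *v v = 0"
    and "x \<bullet> ((M \<otimes>\<^sub>K mat 1) *v x) = 0"
  shows "(M \<otimes>\<^sub>K mat 1) *v x = 0"
  using assms(3) psd null
  by (simp add: kronecker_form sum_nonneg_eq_0_iff eq_0_iff_layers layer_kronecker)

lemma kronecker_gap:
  fixes M :: "real^'n^'n"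
  assumes gap: "\<And>v. (\<And>c. M *v c = 0 \<Longrightarrow> c \<bullet> v = 0) \<Longrightarrow> \<Lambda> * (v \<bullet> v) \<le> 2 * (v \<bullet> (M *v v))"
    and orth: "\<And>c :: real^('n \<times> 'd::finite). (M \<otimes>\<^sub>K mat 1) *v c = 0 \<Longrightarrow> c \<bullet> w = 0"
  shows "\<Lambda> * (w \<bullet> w) \<le> 2 * (w \<bullet> ((M \<otimes>\<^sub>K mat 1) *v w))"
proof -
  have "c \<bullet> layer w k = 0" if c: "M *v c = 0" for c k
  proof -
    \<comment> \<open>placing a kernel vector of \<open>M\<close> in one layer gives a kernel vector of the Kronecker product\<close>
    define e :: "real^('n \<times> 'd)" where "e = (\<chi> p. if snd p = k then c $ fst p else 0)"
    have e: "layer e k' = (if k' = k then c else 0)" for k'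
      by (simp add: layer_def e_def vec_eq_iff)
    have "(M \<otimes>\<^sub>K mat 1) *v e = 0" by (simp add: eq_0_iff_layers layer_kronecker e c)
    from orth[OF this] show ?thesis
      by (simp add: inner_layers e if_distrib[of "\<lambda>a. a \<bullet> _"] cong: if_cong)
  qed
  then have "\<Lambda> * (layer w k \<bullet> layer w k) \<le> 2 * (layer w k \<bullet> (M *v layer w k))" for k
    by (intro gap)
  then show ?thesis
    unfolding kronecker_form inner_layers[of w w] sum_distrib_left by (intro sum_mono)
qed

section \<open>The separable objective\<close>

lemma linear_block: "linear (\<lambda>x. block x i)"
  by (rule linearI) (auto simp: block_def vec_eq_iff)

lemma f_tilde_convex:
  fixes f :: "'n::finite \<Rightarrow> real^'d::finite \<Rightarrow> real"
  assumes "\<And>i. convex_on UNIV (f i)"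
  shows "convex_on UNIV (f_tilde f)"
proof (rule convex_onI)
  fix t :: real and x y :: "real^('n \<times> 'd)"
  assume t: "0 < t" "t < 1"
  have "f i (block ((1 - t) *\<^sub>R x + t *\<^sub>R y) i) \<le> (1 - t) * f i (block x i) + t * f i (block y i)" for i
    using convex_onD[OF assms, of t "block x i" "block y i" i] t
    by (simp add: linear_add[OF linear_block] linear_scale[OF linear_block])
  then show "f_tilde f ((1 - t) *\<^sub>R x + t *\<^sub>R y) \<le> (1 - t) * f_tilde f x + t * f_tilde f y"
    unfolding f_tilde_def sum_distrib_left sum.distrib[symmetric] by (intro sum_mono)
qed simp

lemma f_tilde_differentiable:
  fixes f :: "'n::finite \<Rightarrow> real^'d::finite \<Rightarrow> real"
  assumes "\<And>i x. f i differentiable at x"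
  shows "f_tilde f differentiable at x"
proof -
  have "(\<lambda>x. f i (block x i)) differentiable at x" for i
    by (rule differentiable_compose[of "f i"])
      (use assms in \<open>auto intro: linear_imp_differentiable linear_block\<close>)
  then show ?thesis unfolding f_tilde_def[abs_def] by (intro differentiable_sum) auto
qed

section \<open>The convergence theorem\<close>

theorem theoremV4:
  fixes E :: "('n::finite \<times> 'n) set"
    and A L :: "real^'n^'n"
    and LL :: "real^('n \<times> 'd::finite)^('n \<times> 'd)"
    and f :: "'n \<Rightarrow> real^'d \<Rightarrow> real"
    and K :: real
  assumes "weighted_digraph E A"
    and "strongly_connected E"
    and "weight_balanced A"
    and "CARD('n) \<ge> 2"
    and "L = laplacian A"
    and "LL = L \<otimes>\<^sub>K (mat 1 :: real^'d^'d)"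
    and "\<And>i. convex_on UNIV (f i)"
    and "\<And>i x. f i differentiable at x"
    and "\<And>i. \<exists>C. C-lipschitz_on UNIV (grad (f i))"
    and "\<exists>x. is_arg_min (f_sum f) (\<lambda>_. True) x"
    and "K > 0"
    and "K-lipschitz_on UNIV (grad (f_tilde f))"
  shows "\<exists>\<beta>'>0. h_fun L K \<beta>' = 0 \<and>
    (\<forall>\<beta>. 0 < \<beta> \<and> \<beta> < \<beta>' \<longrightarrow>
      (\<forall>x z. is_trajectory LL (f_tilde f) ((\<beta>^2 + 2) / \<beta>) x z \<longrightarrow>
         converges_to_set x (solution_set LL (f_tilde f)) \<and>
         (finite {y. grad (f_sum f) y = 0} \<longrightarrow>
           (\<exists>l \<in> solution_set LL (f_tilde f). (x \<longlongrightarrow> l) at_top))))"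
proof -
  let ?\<Lambda> = "Lambda_star (L + transpose L)"
  let ?F = "f_tilde f"
  let ?G = "grad ?F"
  have psd: "0 \<le> v \<bullet> (L *v v)" for v
    unfolding assms(5) by (rule laplacian_psd[OF assms(1,3)])
  have consensus: "v $ i = v $ j" if "L *v v = 0" for v i j
    using laplacian_form_zero_imp_consensus[OF assms(1-3)] that by (simp add: assms(5))
  have null: "L *v v = 0" if "v \<bullet> (L *v v) = 0" for v
    using laplacian_consensus laplacian_form_zero_imp_consensus[OF assms(1-3)] that
    unfolding assms(5) by blast
  obtain i0 i1 :: 'n where "i0 \<noteq> i1"
    using assms(4) by (metis One_nat_def card_le_Suc0_iff_eq finite iso_tuple_UNIV_I not_less_eq_eq numeral_2_eq_2)
  \<comment> \<open>a non-consensus vector exists because there are two vertices; it is not in the kernel\<close>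
  then have ne: "L *v axis i0 1 \<noteq> 0" using consensus[of "axis i0 1" i0 i1] by (auto simp: axis_def)
  have \<Lambda>: "0 < ?\<Lambda>"
    by (rule Lambda_star_spectral_gap(1)[OF psd _ ne]) (rule null)
  have gap: "?\<Lambda> * (v \<bullet> v) \<le> 2 * (v \<bullet> (L *v v))" if "\<And>c. L *v c = 0 \<Longrightarrow> c \<bullet> v = 0" for v
    by (rule Lambda_star_spectral_gap(2)[OF psd _ ne]) (fact null that)+
  obtain \<beta>' where \<beta>': "0 < \<beta>'" "h_fun L K \<beta>' = 0" "\<And>r. 0 < r \<Longrightarrow> r < \<beta>' \<Longrightarrow> h_fun L K r < 0"
    using h_fun_first_zero[OF \<Lambda> assms(11)] by blast
  have conv: "convex_on UNIV ?F" by (intro f_tilde_convex assms)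
  have grad: "GDERIV ?F x :> ?G x" for x by (intro GDERIV_grad f_tilde_differentiable assms)
  have LLc: "block y i = block y j" if "LL *v y = 0" for y i j
  proof -
    have "L *v layer y k = 0" for k using that by (simp add: assms(6) eq_0_iff_layers layer_kronecker)
    from consensus[OF this] show ?thesis by (simp add: block_def layer_def vec_eq_iff)
  qed
  obtain x0 where x0: "\<And>y. f_sum f x0 \<le> f_sum f y" using assms(10) by (auto simp: is_arg_min_linorder)
  define xs :: "real^('n \<times> 'd)" where "xs = (\<chi> p. x0 $ snd p)"
  have xs0: "LL *v xs = 0"
  proof -
    have "L *v layer xs k = 0" for k
      unfolding assms(5) by (rule laplacian_consensus) (simp add: layer_def xs_def)
    then show ?thesis by (simp add: assms(6) eq_0_iff_layers layer_kronecker)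
  qed
  have xs_min: "?F xs \<le> ?F y" if "LL *v y = 0" for y
  proof -
    have "?F xs = f_sum f x0" by (simp add: f_tilde_def f_sum_def block_def xs_def vec_lambda_eta)
    also have "\<dots> \<le> f_sum f (block y i0)" by (rule x0)
    also have "\<dots> = ?F y" using LLc[OF that] by (simp add: f_tilde_def f_sum_def) metis
    finally show ?thesis .
  qed
  have xs_orth: "c \<bullet> ?G xs = 0" if "LL *v c = 0" for c
    by (rule minimizer_on_subspace_gradient[of ?F, OF grad], rule xs_min)
      (simp add: matrix_vector_right_distrib matrix_vector_mult_scaleR xs0 that)
  have "\<exists>l \<in> solution_set LL ?F. (x \<longlongrightarrow> l) at_top"
    if \<beta>: "0 < \<beta>" "\<beta> < \<beta>'" and traj: "is_trajectory LL ?F ((\<beta>^2 + 2) / \<beta>) x z" for \<beta> x z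
  proof -
    have x': "(x has_vector_derivative - ?G (x t) - ((\<beta>\<^sup>2 + 2) / \<beta>) *\<^sub>R (LL *v x t) - LL *v z t)
        (at t within {0..})" and z': "(z has_vector_derivative LL *v x t) (at t within {0..})"
      if t: "0 \<le> t" for t
    proof -
      obtain a b where *: "(x has_vector_derivative a) (at t within {0..})"
        "(z has_vector_derivative b) (at t within {0..})"
        "a + ((\<beta>\<^sup>2 + 2) / \<beta>) *\<^sub>R (LL *v x t) + LL *v z t = - ?G (x t)" "b = LL *v x t"
        using traj t unfolding is_trajectory_def by blast
      have "a = - ?G (x t) - ((\<beta>\<^sup>2 + 2) / \<beta>) *\<^sub>R (LL *v x t) - LL *v z t"
        using *(3) by (simp add: algebra_simps flip: *(3))
      with * show "(x has_vector_derivative - ?G (x t) - ((\<beta>\<^sup>2 + 2) / \<beta>) *\<^sub>R (LL *v x t) - LL *v z t)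
        (at t within {0..})" "(z has_vector_derivative LL *v x t) (at t within {0..})" by auto
    qed
    have "\<exists>l. LL *v l = 0 \<and> ?G l = ?G xs \<and> (x \<longlongrightarrow> l) at_top"
    proof (rule saddle_flow_converges[of "(*v) LL" ?\<Lambda> ?F ?G K \<beta> x z xs])
      show "1 / 2 * ?\<Lambda> * (- ((\<beta>^4 + 3 * \<beta>^2 + 2) / \<beta>)
          + sqrt (((\<beta>^4 + 3 * \<beta>^2 + 2) / \<beta>)\<^sup>2 - 4)) + K * \<beta>^2 / (1 + \<beta>^2) < 0"
        using \<beta>'(3)[OF \<beta>] by (simp add: h_fun_def)
      show "0 \<le> v \<bullet> (LL *v v)" for v unfolding assms(6) by (rule kronecker_psd[OF psd])
      show "LL *v v = 0" if "v \<bullet> (LL *v v) = 0" for v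
        using that unfolding assms(6) by (intro kronecker_null psd null)
      show "?\<Lambda> * (w \<bullet> w) \<le> 2 * (w \<bullet> (LL *v w))" if "\<And>c. LL *v c = 0 \<Longrightarrow> c \<bullet> w = 0" for w
        using that unfolding assms(6) by (intro kronecker_gap gap)
    qed (use conv grad assms(11,12) \<beta> x' z' xs0 xs_orth in auto)
    then obtain l where l: "LL *v l = 0" "?G l = ?G xs" "(x \<longlongrightarrow> l) at_top" by blast
    have "?F l \<le> ?F y" if "LL *v y = 0" for y
    proof -
      have "LL *v (y - l) = 0" by (simp add: matrix_vector_mult_diff_distrib that l)
      from xs_orth[OF this] have "?G l \<bullet> (y - l) = 0" by (simp add: l inner_commute)
      with convex_gradient_inequality[OF conv grad, of l y] show ?thesis by simp
    qed
    then have "l \<in> solution_set LL ?F" by (simp add: solution_set_def is_arg_min_linorder l)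
    with l show ?thesis by blast
  qed
  moreover have "converges_to_set x S" if ex: "\<exists>l\<in>S. (x \<longlongrightarrow> l) at_top"
    for S and x :: "real \<Rightarrow> real^('n \<times> 'd)"
  proof -
    obtain l where l: "l \<in> S" "(x \<longlongrightarrow> l) at_top" using ex by blast
    show ?thesis unfolding converges_to_set_def
    proof (intro allI impI)
      fix e :: real assume "0 < e"
      from tendstoD[OF l(2) this] show "\<forall>\<^sub>F t in at_top. \<exists>y\<in>S. dist (x t) y < e"
        by eventually_elim (use l in blast)
    qed
  qed
  ultimately show ?thesis using \<beta>'(1,2) by blast
qed

end
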